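(* Let $z_1,z_2\in\mathbb{C}$. Assume that the segment $[z_1,z_2]$ is either in $\mathbb{D}$, or in $\mathbb{C}\setminus\overline{\mathbb{D}}$, and that $0,\,z_1,\,z_2$ are not collinear. Then the point $z\in\partial\mathbb{D}$ is a PA-point (with respect to $z_1,z_2$) if and only if $z$ is written as $$z=\pm\frac{tz_2+(1-t)z_1}{|tz_2+(1-t)z_1|}$$ for some $t\in(0,1)$ such that $$(1-2t)^2\Big((1-t)^2|z_1|^2+t^2|z_2|^2+2t(1-t)\,\mathrm{Re}\,(z_1\overline{z_2})\Big)=\Big((1-t)^2|z_1|^2-t^2|z_2|^2\Big)^2.$$
   Context: $\mathbb{D}=\{z\in\mathbb{C}:|z|<1\}$ is the unit disk, $\overline{\mathbb{D}}$ its closure and $\partial\mathbb{D}$ the unit circle; $[z_1,z_2]$ is the line segment joining $z_1$ and $z_2$. A point $u\in\partial\mathbb{D}$ is called a PA-point (reflection point in the Ptolemy-Alhazen problem) with respect to $z_1,z_2$ if $|\angle(z_1,u,0)|=|\angle(0,u,z_2)|$, where $\angle(a,u,b)$ denotes the angle at the vertex $u$ between the rays from $u$ to $a$ and from $u$ to $b$.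
   Formalization: The angles are compared as oriented angles (absolute values would admit circle points where z1, z2 lie on one ray), and the sign ± is tied to t by requiring ±(1-2t)((1-t)²|z1|²-t²|z2|²) ≥ 0, since the squared equation alone also admits points that are not PA-points. *)

theory Defs
  imports "HOL-Analysis.Analysis"
begin

text \<open>
  The measure, in the interval from \<open>-pi\<close> (excluded) to \<open>pi\<close> (included), of the angle at the
  vertex \<open>u\<close> from the ray from \<open>u\<close> to \<open>a\<close> to the ray from \<open>u\<close> to \<open>b\<close>. It is oriented, so swapping
  \<open>a\<close> and \<open>b\<close> changes its sign (except for the value \<open>pi\<close>).
  It is only meaningful if \<open>a \<noteq> u\<close> and \<open>b \<noteq> u\<close>.
\<close>
definition angle_at :: "complex \<Rightarrow> complex \<Rightarrow> complex \<Rightarrow> real" where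
  "angle_at a u b = Arg ((b - u) / (a - u))"

text \<open>
  The two angles are compared as oriented angles: a ray coming from \<open>z1\<close> is reflected at \<open>u\<close> in
  the normal line through \<open>0\<close> and \<open>u\<close>. Comparing only their absolute values would also admit the
  points \<open>u\<close> where the line through \<open>z1\<close> and \<open>z2\<close> meets the unit circle outside the segment; there
  the rays to \<open>z1\<close> and \<open>z2\<close> coincide and nothing is reflected.
\<close>
definition PA_point :: "complex \<Rightarrow> complex \<Rightarrow> complex \<Rightarrow> bool" where
  "PA_point z1 z2 u \<longleftrightarrow> u \<in> sphere 0 1 \<and> angle_at z1 u 0 = angle_at 0 u z2"

end

theory Submission
  imports Defs
begin

text \<open>
  Rotate so that the point on the circle is \<open>1\<close>, and write \<open>a\<close> and \<open>b\<close> for the rotated points.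
  Equality of the two oriented angles says that \<open>(1 - a) * (1 - b)\<close> is a positive real number.
  If \<open>w = t * b + (1 - t) * a\<close> is real, then \<open>(1 - t) * a = p + \<i> * h\<close> and \<open>t * b = q - \<i> * h\<close>, so
  the difference of their squared moduli is \<open>(p - q) * w\<close>. The equation for \<open>t\<close> together with the
  sign condition thus reads \<open>1 - 2 * t = p - q\<close>, which says that \<open>(1 - a) * (1 - b)\<close> is real.
  Its positivity amounts to \<open>a\<close> and \<open>b\<close> lying on opposite sides of the real line, that is, to
  \<open>0 < t < 1\<close>.
\<close>

lemma Arg_eq_Arg_iff:
  assumes "x \<noteq> 0" "y \<noteq> 0"
  shows "Arg x = Arg y \<longleftrightarrow> Im (y / x) = 0 \<and> 0 < Re (y / x)"
proof -
  have "Im (y / x) = 0 \<and> 0 < Re (y / x) \<longleftrightarrow> (\<exists>r::real. 0 < r \<and> y / x = of_real r)"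
    by (metis Im_complex_of_real Re_complex_of_real complex_is_Real_iff of_real_Re)
  also have "\<dots> \<longleftrightarrow> (\<exists>r::real. 0 < r \<and> y = of_real r * x)"
    using assms by (simp add: divide_eq_eq)
  also have "\<dots> \<longleftrightarrow> Arg y = Arg x"
    using assms by (simp add: Arg_eq_iff)
  finally show ?thesis
    by auto
qed

text \<open>Equal arguments mean a positive quotient, and in the quotient of the two ratios defining
  the angles the factors \<open>u\<close> combine to give
  \<open>(1 - z1 / u) * (1 - z2 / u)\<close>.\<close>

lemma PA_point_iff:
  assumes "u \<in> sphere 0 1" "z1 \<noteq> u" "z2 \<noteq> u"
  shows "PA_point z1 z2 u \<longleftrightarrow>
    Im ((1 - z1 / u) * (1 - z2 / u)) = 0 \<and> 0 < Re ((1 - z1 / u) * (1 - z2 / u))"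
proof -
  have u: "u \<noteq> 0"
    using assms by auto
  have "((z2 - u) / (0 - u)) / ((0 - u) / (z1 - u)) = (1 - z1 / u) * (1 - z2 / u)"
    using u assms by (simp add: field_simps)
  moreover have "(z2 - u) / (0 - u) \<noteq> 0" "(0 - u) / (z1 - u) \<noteq> 0"
    using u assms by auto
  ultimately show ?thesis
    using assms(1) by (simp add: PA_point_def angle_at_def Arg_eq_Arg_iff del: minus_complex.sel)
qed

lemma collinear_if_Im_mult_cnj_eq_0:
  assumes "Im (z1 * cnj z2) = 0"
  shows "collinear {0, z1, z2}"
proof -
  have "Im (z2 / z1) = 0"
    using assms by (simp add: Im_divide algebra_simps)
  then show ?thesis
    by (simp add: collinear_iff_Reals complex_is_Real_iff)
qed

text \<open>Cancelling \<open>(Re w)\<^sup>2\<close> leaves \<open>1 - 2 * t\<close> and the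
  difference of the real parts of \<open>(1 - t) * a\<close> and \<open>t * b\<close> equal up to
  sign. The inequality rules out nonzero values of opposite sign, because \<open>s\<close> is
  multiplied by a number of the same sign, \<open>Re w\<close>.\<close>

lemma balanced_iff:
  fixes a b :: complex and s t :: real
  assumes w: "w = of_real t * b + of_real (1 - t) * a"
    and "Im w = 0" "s * Re w > 0"
  shows "(1 - 2 * t)\<^sup>2 * (cmod w)\<^sup>2 = ((1 - t)\<^sup>2 * (cmod a)\<^sup>2 - t\<^sup>2 * (cmod b)\<^sup>2)\<^sup>2 \<and>
     0 \<le> s * ((1 - 2 * t) * ((1 - t)\<^sup>2 * (cmod a)\<^sup>2 - t\<^sup>2 * (cmod b)\<^sup>2)) \<longleftrightarrow>
     (1 - t) * (1 - Re a) = t * (1 - Re b)"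
    (is "?eq \<and> ?sign \<longleftrightarrow> ?bal")
proof -
  define d where "d = (1 - t) * Re a - t * Re b"
  have Re_w: "Re w = t * Re b + (1 - t) * Re a"
    by (simp add: w)
  have "Im w = t * Im b + (1 - t) * Im a"
    by (simp add: w)
  then have "t * Im b = - ((1 - t) * Im a)"
    using assms(2) by linarith
  then have "(t * Im b)\<^sup>2 = ((1 - t) * Im a)\<^sup>2"
    by simp
  then have diff: "(1 - t)\<^sup>2 * (cmod a)\<^sup>2 - t\<^sup>2 * (cmod b)\<^sup>2 = d * Re w"
    by (simp add: cmod_power2 Re_w d_def power_mult_distrib) (simp add: algebra_simps power2_eq_square)
  have "cmod w ^ 2 = Re w ^ 2" "Re w \<noteq> 0"
    using assms(2,3) by (auto simp: cmod_power2)
  then have "?eq \<longleftrightarrow> (1 - 2 * t)\<^sup>2 = d\<^sup>2"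
    unfolding diff by (simp add: power_mult_distrib)
  moreover have "s * ((1 - 2 * t) * (d * Re w)) = (s * Re w) * ((1 - 2 * t) * d)"
    by (simp add: algebra_simps)
  \<comment> \<open>Zero is written as a multiple of \<open>s * Re w\<close> so that this positive
    factor can be cancelled.\<close>
  then have "?sign \<longleftrightarrow> (s * Re w) * 0 \<le> (s * Re w) * ((1 - 2 * t) * d)"
    unfolding diff by (simp only: mult_zero_right)
  then have "?sign \<longleftrightarrow> 0 \<le> (1 - 2 * t) * d"
    unfolding mult_le_cancel_left_pos [OF assms(3)] .
  ultimately have "?eq \<and> ?sign \<longleftrightarrow> (1 - 2 * t)\<^sup>2 = d\<^sup>2 \<and> 0 \<le> (1 - 2 * t) * d"
    by simp
  also have "\<dots> \<longleftrightarrow> 1 - 2 * t = d"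
    by (auto simp: power2_eq_iff zero_le_mult_iff)
  also have "\<dots> \<longleftrightarrow> ?bal"
    by (auto simp: d_def algebra_simps)
  finally show ?thesis .
qed

text \<open>The product is positive exactly if \<open>1 - b\<close> is a positive multiple of
  \<open>cnj (1 - a)\<close>. With the multiple written as \<open>(1 - t) / t\<close>, the two
  equations for \<open>t\<close> are the imaginary and real parts of
  \<open>t * (1 - b) = (1 - t) * cnj (1 - a)\<close>.\<close>

lemma mult_one_minus_pos_real_iff:
  fixes a b :: complex
  assumes "a \<noteq> 1" "b \<noteq> 1" "Im (a * cnj b) \<noteq> 0"
  shows "Im ((1 - a) * (1 - b)) = 0 \<and> 0 < Re ((1 - a) * (1 - b)) \<longleftrightarrow>
    (\<exists>t. 0 < t \<and> t < 1 \<and> t * Im b + (1 - t) * Im a = 0 \<and> (1 - t) * (1 - Re a) = t * (1 - Re b))"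
    (is "?L \<longleftrightarrow> ?R")
proof
  assume ?L
  then have im: "(1 - Re a) * Im b + (1 - Re b) * Im a = 0"
    and re: "Im a * Im b < (1 - Re a) * (1 - Re b)"
    by (simp_all add: algebra_simps)
  \<comment> \<open>If one of the points were real, \<open>im\<close> would make it equal to 1 or
    make both real.\<close>
  have a: "Im a \<noteq> 0" and b: "Im b \<noteq> 0"
    using im assms by (auto simp: complex_eq_iff)
  \<comment> \<open>If the imaginary parts had the same sign, \<open>im\<close> would prevent
    \<open>1 - Re a\<close> and \<open>1 - Re b\<close> from having a positive product, while
    \<open>re\<close> would force one.\<close>
  have opp: "Im a * Im b < 0"
  proof (rule ccontr)
    assume "\<not> Im a * Im b < 0"
    then have "0 < Im a * Im b"
      using a b by (simp add: not_less order_less_le)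
    moreover have "(1 - Re a) * Im b = - ((1 - Re b) * Im a)"
      using im by linarith
    then have "((1 - Re a) * Im b) * ((1 - Re b) * Im a) = - ((1 - Re b) * Im a)\<^sup>2"
      by (simp only: power2_eq_square mult_minus_left)
    then have "(1 - Re a) * (1 - Re b) * (Im a * Im b) = - ((1 - Re b) * Im a)\<^sup>2"
      by (simp add: mult_ac)
    then have "(1 - Re a) * (1 - Re b) * (Im a * Im b) \<le> 0"
      by simp
    moreover have "0 < (1 - Re a) * (1 - Re b)"
      using re \<open>0 < Im a * Im b\<close> by linarith
    ultimately show False
      by (meson mult_pos_pos not_less)
  qed
  \<comment> \<open>The parameter at which the segment from \<open>a\<close> to \<open>b\<close>
    crosses the real line.\<close>
  define t where "t = Im a / (Im a - Im b)"
  have ne: "Im a - Im b \<noteq> 0"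
    using opp by (auto simp: not_less [symmetric])
  have t': "1 - t = - Im b / (Im a - Im b)"
    using ne by (simp add: t_def field_simps)
  have "0 < t" "0 < 1 - t"
    unfolding t' unfolding t_def using opp by (auto simp: mult_less_0_iff zero_less_divide_iff divide_less_0_iff)
  moreover have "t * Im b + (1 - t) * Im a = 0"
    unfolding t' unfolding t_def by (simp add: field_simps)
  moreover have "- Im b * (1 - Re a) = Im a * (1 - Re b)"
    using im by (simp add: algebra_simps)
  then have "(1 - t) * (1 - Re a) = t * (1 - Re b)"
    unfolding t' unfolding t_def by (simp only: times_divide_eq_left)
  ultimately show ?R
    by auto
next
  assume ?R
  then obtain t where t: "0 < t" "t < 1" and im: "t * Im b = - ((1 - t) * Im a)"
    and re: "t * (1 - Re b) = (1 - t) * (1 - Re a)"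
    by (metis eq_neg_iff_add_eq_0)
  have "Im a \<noteq> 0"
    using im t assms(3) by auto
  \<comment> \<open>The factor \<open>t\<close> allows \<open>im\<close> and \<open>re\<close> to
    eliminate \<open>b\<close>; the real part then becomes \<open>1 - t\<close> times the squared
    modulus of \<open>1 - a\<close>.\<close>
  have "t * Im ((1 - a) * (1 - b)) = - ((1 - Re a) * (t * Im b) + (t * (1 - Re b)) * Im a)"
    by (simp add: algebra_simps)
  also have "\<dots> = 0"
    unfolding im re by (simp add: algebra_simps)
  finally have "Im ((1 - a) * (1 - b)) = 0"
    using t by simp
  moreover have "t * Re ((1 - a) * (1 - b)) = (1 - Re a) * (t * (1 - Re b)) - Im a * (t * Im b)"
    by (simp add: algebra_simps)
  then have "t * Re ((1 - a) * (1 - b)) = (1 - t) * ((1 - Re a)\<^sup>2 + (Im a)\<^sup>2)"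
    unfolding im re by (simp add: algebra_simps power2_eq_square)
  then have "0 < t * Re ((1 - a) * (1 - b))"
    using t \<open>Im a \<noteq> 0\<close> by (simp add: add_nonneg_pos)
  then have "0 < Re ((1 - a) * (1 - b))"
    using t by (simp add: zero_less_mult_iff)
  ultimately show ?L
    by simp
qed

lemma sign_mult_normalized_eq_1_iff:
  fixes w :: complex and s :: real
  assumes "s \<in> {1, -1}"
  shows "of_real s * (w / of_real (cmod w)) = 1 \<longleftrightarrow> Im w = 0 \<and> 0 < s * Re w"
proof
  assume *: "of_real s * (w / of_real (cmod w)) = 1"
  then have "w \<noteq> 0"
    by auto
  with * have "of_real s * w = of_real (cmod w)"
    by (simp add: divide_eq_eq)
  then have "w = of_real (s * cmod w)"
    using assms by (auto simp: minus_equation_iff [of w])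
  then have "Im w = 0" "Re w = s * cmod w"
    by (metis Im_complex_of_real, metis Re_complex_of_real)
  then show "Im w = 0 \<and> 0 < s * Re w"
    using assms \<open>w \<noteq> 0\<close> by auto
next
  assume *: "Im w = 0 \<and> 0 < s * Re w"
  then have "w = of_real (Re w)" "cmod w = \<bar>Re w\<bar>"
    by (auto simp: complex_eq_iff cmod_eq_Re)
  with * assms show "of_real s * (w / of_real (cmod w)) = 1"
    by (auto simp: complex_eq_iff)
qed

(* s is the sign in the formula for z. The equation for t is the square of
   s * (1 - 2 * t) * |w| = (1 - t)^2 * |z1|^2 - t^2 * |z2|^2 with w = t * z2 + (1 - t) * z1,
   so each solution t belongs to the sign s that makes the two sides agree in sign; the
   inequality selects it. Both signs are allowed when the two sides vanish. *)
theorem proposition3p2: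
  fixes z1 z2 z :: complex
  assumes "closed_segment z1 z2 \<subseteq> ball 0 1 \<or> closed_segment z1 z2 \<subseteq> - cball 0 1"
    and "\<not> collinear {0, z1, z2}"
    and "z \<in> sphere 0 1"
  shows "PA_point z1 z2 z \<longleftrightarrow>
    (\<exists>t::real. \<exists>s::real. 0 < t \<and> t < 1 \<and> s \<in> {1, -1} \<and>
       z = of_real s * ((of_real t * z2 + of_real (1 - t) * z1) /
                        of_real (cmod (of_real t * z2 + of_real (1 - t) * z1))) \<and>
       (1 - 2 * t)\<^sup>2 * ((1 - t)\<^sup>2 * (cmod z1)\<^sup>2 + t\<^sup>2 * (cmod z2)\<^sup>2
                       + 2 * t * (1 - t) * Re (z1 * cnj z2))
         = ((1 - t)\<^sup>2 * (cmod z1)\<^sup>2 - t\<^sup>2 * (cmod z2)\<^sup>2)\<^sup>2 \<and>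
       0 \<le> s * ((1 - 2 * t) * ((1 - t)\<^sup>2 * (cmod z1)\<^sup>2 - t\<^sup>2 * (cmod z2)\<^sup>2)))"
proof -
  define a where "a = z1 / z"
  define b where "b = z2 / z"
  define w where "w t = of_real t * b + of_real (1 - t) * a" for t :: real
  have norm_z: "cmod z = 1" and z: "z \<noteq> 0"
    using assms(3) by auto
  \<comment> \<open>The segment hypothesis keeps both endpoints off the unit circle.\<close>
  have ne: "z1 \<noteq> z" "z2 \<noteq> z"
    using assms(1,3) by (auto simp: subset_iff)
  then have ab: "a \<noteq> 1" "b \<noteq> 1"
    using z by (auto simp: a_def b_def)
  have z12: "z1 = a * z" "z2 = b * z"
    using z by (simp_all add: a_def b_def)
  have norm_ab: "cmod z1 = cmod a" "cmod z2 = cmod b"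
    by (simp_all add: a_def b_def norm_divide norm_z)
  \<comment> \<open>The rotation preserves \<open>z1 * cnj z2\<close> as well as the moduli, so the
    equation for \<open>t\<close> keeps its form.\<close>
  have "z * cnj z = 1"
    by (simp add: complex_norm_square [symmetric] norm_z)
  then have cross: "z1 * cnj z2 = a * cnj b"
    by (simp add: z12 mult.assoc mult.left_commute [of z])
  then have im_ab: "Im (a * cnj b) \<noteq> 0"
    using assms(2) collinear_if_Im_mult_cnj_eq_0 by metis
  have comb: "of_real t * z2 + of_real (1 - t) * z1 = w t * z" for t
    by (simp add: w_def z12 algebra_simps)
  have w_norm: "(1 - t)\<^sup>2 * (cmod z1)\<^sup>2 + t\<^sup>2 * (cmod z2)\<^sup>2 + 2 * t * (1 - t) * Re (z1 * cnj z2)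
      = (cmod (w t))\<^sup>2" for t
    unfolding cross norm_ab w_def
    by (simp add: cmod_power2) (simp add: algebra_simps power2_eq_square)
  have z_eq: "z = of_real s * (w t * z / of_real (cmod (w t * z))) \<longleftrightarrow> Im (w t) = 0 \<and> 0 < s * Re (w t)"
    if "s \<in> {1, -1}" for s t
  proof -
    have "z = of_real s * (w t * z / of_real (cmod (w t * z))) \<longleftrightarrow>
        1 * z = of_real s * (w t / of_real (cmod (w t))) * z"
      by (simp add: norm_mult norm_z mult.assoc)
    also have "\<dots> \<longleftrightarrow> of_real s * (w t / of_real (cmod (w t))) = 1"
      using z by (metis mult_right_cancel)
    also have "\<dots> \<longleftrightarrow> Im (w t) = 0 \<and> 0 < s * Re (w t)"
      using that by (rule sign_mult_normalized_eq_1_iff)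
    finally show ?thesis .
  qed
  \<comment> \<open>If \<open>w t\<close> were 0, \<open>a\<close> and \<open>b\<close> would be
    real multiples of one another, contrary to \<open>im_ab\<close>. A real \<open>w t\<close> is
    thus nonzero and determines \<open>s\<close>.\<close>
  have sign: "\<exists>s\<in>{1, -1}. 0 < s * Re (w t)" if "Im (w t) = 0" "0 < t" for t
  proof -
    have "Re (w t) \<noteq> 0"
    proof
      assume "Re (w t) = 0"
      then have "t * Re b = - ((1 - t) * Re a)" "t * Im b = - ((1 - t) * Im a)"
        using that(1) by (simp_all add: w_def)
      moreover have "t * Im (a * cnj b) = Im a * (t * Re b) - Re a * (t * Im b)"
        by (simp add: algebra_simps)
      ultimately have "t * Im (a * cnj b) = 0"
        by simp
      then show False
        using im_ab that(2) by simp
    qed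
    then show ?thesis
      by (cases "0 < Re (w t)") auto
  qed
  have "PA_point z1 z2 z \<longleftrightarrow>
      (\<exists>t. 0 < t \<and> t < 1 \<and> Im (w t) = 0 \<and> (1 - t) * (1 - Re a) = t * (1 - Re b))"
    unfolding PA_point_iff [OF assms(3) ne] a_def [symmetric] b_def [symmetric]
      mult_one_minus_pos_real_iff [OF ab im_ab]
    by (simp add: w_def)
  also have "\<dots> \<longleftrightarrow> (\<exists>t s. 0 < t \<and> t < 1 \<and> s \<in> {1, -1} \<and>
      (Im (w t) = 0 \<and> 0 < s * Re (w t)) \<and> (1 - t) * (1 - Re a) = t * (1 - Re b))"
    using sign by blast
  also have "\<dots> \<longleftrightarrow> (\<exists>t s. 0 < t \<and> t < 1 \<and> s \<in> {1, -1} \<and>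
      (Im (w t) = 0 \<and> 0 < s * Re (w t)) \<and>
      (1 - 2 * t)\<^sup>2 * (cmod (w t))\<^sup>2 = ((1 - t)\<^sup>2 * (cmod a)\<^sup>2 - t\<^sup>2 * (cmod b)\<^sup>2)\<^sup>2 \<and>
      0 \<le> s * ((1 - 2 * t) * ((1 - t)\<^sup>2 * (cmod a)\<^sup>2 - t\<^sup>2 * (cmod b)\<^sup>2)))"
    \<comment> \<open>The congruence rule supplies \<open>Im (w t) = 0\<close> and
      \<open>0 < s * Re (w t)\<close>, the hypotheses of \<open>balanced_iff\<close>, from the
      preceding conjunct.\<close>
    using balanced_iff [OF w_def] by (intro ex_cong1 conj_cong refl) blast
  also have "\<dots> \<longleftrightarrow> (\<exists>t s. 0 < t \<and> t < 1 \<and> s \<in> {1, -1} \<and>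
      z = of_real s * (w t * z / of_real (cmod (w t * z))) \<and>
      (1 - 2 * t)\<^sup>2 * (cmod (w t))\<^sup>2 = ((1 - t)\<^sup>2 * (cmod a)\<^sup>2 - t\<^sup>2 * (cmod b)\<^sup>2)\<^sup>2 \<and>
      0 \<le> s * ((1 - 2 * t) * ((1 - t)\<^sup>2 * (cmod a)\<^sup>2 - t\<^sup>2 * (cmod b)\<^sup>2)))"
    by (intro ex_cong1 conj_cong refl) (rule z_eq [symmetric])
  finally show ?thesis
    unfolding comb w_norm unfolding norm_ab .
qed

end
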